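(* Let $K,L\subset \mathbb{R}^2$ be origin-symmetric convex integer polygons. If $$|(K\cap \mathbb{Z}^2)|u^\perp|=|(L\cap \mathbb{Z}^2)|u^\perp|$$ and $$|(2K\cap \mathbb{Z}^2)|u^\perp|=|(2L\cap \mathbb{Z}^2)|u^\perp|$$ for all $u\in \mathbb{Z}^2$, then $K=L$.
   Context: A convex body in $\mathbb{R}^n$ is a compact convex set with nonempty interior. For $t\in\mathbb{R}$, $tK=\{tx: x\in K\}$. A set $K$ is origin-symmetric if $K=-K$. A convex integer polygon is a convex polygon in $\mathbb{R}^2$ (a convex body that is a polytope) all of whose vertices lie in $\mathbb{Z}^2$. For $u\in\mathbb{R}^2$, $u^\perp=\{x\in\mathbb{R}^2:\langle x,u\rangle=0\}$. For a set $A\subset\mathbb{R}^2$, $A|u^\perp$ denotes the image of $A$ under orthogonal projection onto $u^\perp$, and for a finite set $A$, $|A|u^\perp|$ denotes the cardinality of the projected set $A|u^\perp$. *)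

theory Defs
  imports "HOL-Analysis.Analysis"
begin

definition convex_body :: "'a::euclidean_space set \<Rightarrow> bool" where
  "convex_body K \<longleftrightarrow> compact K \<and> convex K \<and> interior K \<noteq> {}"

definition origin_symmetric :: "'a::real_vector set \<Rightarrow> bool" where
  "origin_symmetric K \<longleftrightarrow> K = uminus ` K"

definition dilate :: "real \<Rightarrow> 'a::real_vector set \<Rightarrow> 'a set" where
  "dilate t K = (\<lambda>x. t *\<^sub>R x) ` K"

definition integer_lattice :: "(real ^ 'n) set" where
  "integer_lattice = {x. \<forall>i. x $ i \<in> \<int>}"

text \<open>The vertices of a polytope are its extreme points.\<close>

definition convex_integer_polygon :: "(real ^ 2) set \<Rightarrow> bool" where
  "convex_integer_polygon K \<longleftrightarrow>
     convex_body K \<and> polytope K \<and> {v. v extreme_point_of K} \<subseteq> integer_lattice"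

definition orthogonal_projection :: "'a::euclidean_space set \<Rightarrow> 'a \<Rightarrow> 'a" where
  "orthogonal_projection W x = (THE y. y \<in> W \<and> x - y \<in> W\<^sup>\<bottom>)"

definition perp_projection :: "'a::euclidean_space set \<Rightarrow> 'a \<Rightarrow> 'a set" where
  "perp_projection A u = orthogonal_projection ({u}\<^sup>\<bottom>) ` A"

text \<open>The formula covers \<open>u = 0\<close> as well: then \<open>{u}\<^sup>\<bottom>\<close> is the whole space, the projection
  is the identity, and division by zero yields zero.\<close>

lemma orthogonal_projection_perp:
  fixes u x :: "'a::euclidean_space"
  shows "orthogonal_projection ({u}\<^sup>\<bottom>) x = x - ((x \<bullet> u) / (u \<bullet> u)) *\<^sub>R u"
  unfolding orthogonal_projection_def
proof (rule the_equality)
  let ?p = "x - ((x \<bullet> u) / (u \<bullet> u)) *\<^sub>R u"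
  have p: "?p \<in> {u}\<^sup>\<bottom>"
    by (auto simp: orthogonal_comp_def orthogonal_def inner_diff_right inner_commute)
  moreover have d: "x - ?p \<in> {u}\<^sup>\<bottom>\<^sup>\<bottom>"
    by (auto simp: orthogonal_comp_def orthogonal_def inner_commute)
  ultimately show "?p \<in> {u}\<^sup>\<bottom> \<and> x - ?p \<in> {u}\<^sup>\<bottom>\<^sup>\<bottom>" ..
  fix y assume y: "y \<in> {u}\<^sup>\<bottom> \<and> x - y \<in> {u}\<^sup>\<bottom>\<^sup>\<bottom>"
  have "y - ?p \<in> {u}\<^sup>\<bottom>"
    using p y subspace_diff[OF subspace_orthogonal_comp] by blast
  moreover have "(x - ?p) - (x - y) \<in> {u}\<^sup>\<bottom>\<^sup>\<bottom>"
    using d y subspace_diff[OF subspace_orthogonal_comp] by blast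
  then have "y - ?p \<in> {u}\<^sup>\<bottom>\<^sup>\<bottom>"
    by (simp add: algebra_simps)
  ultimately have "(y - ?p) \<bullet> (y - ?p) = 0"
    unfolding orthogonal_comp_def[of "{u}\<^sup>\<bottom>"] orthogonal_def by blast
  then show "y = ?p"
    by simp
qed

end

theory Submission
  imports Defs
begin

text \<open>The two polygons play the same role, so it is enough to show \<open>K \<subseteq> L\<close>, and for this it is enough
that every line carrying an edge of \<open>L\<close> bounds a half-plane containing \<open>K\<close>.

Let \<open>u\<close> be the primitive integer vector along an edge of \<open>L\<close>, and measure the position of a point
\<open>x\<close> by its height \<open>cross2 u x\<close>, which is an integer at lattice points.  Two points have the same
projection onto the orthogonal complement of \<open>u\<close> exactly if they have the same height, so the
hypotheses compare the numbers of heights of lattice points.  Let the edge lie at height \<open>h > 0\<close>.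
The parallelogram spanned by a segment from \<open>v\<close> to \<open>v + u\<close> of the edge and its reflection in
the origin meets every line of height \<open>j \<in> {-h..h}\<close> in a translate of \<open>[0, u]\<close>, hence
in a lattice point.  So \<open>L\<close> has exactly \<open>2 h + 1\<close> heights, and \<open>2 L\<close> has at most \<open>4 h + 1\<close>.

Now let \<open>A\<close> be the set of heights of lattice points of \<open>K\<close>.  It has \<open>2 h + 1\<close> elements, while
all elements of \<open>A + A\<close> are heights of \<open>2 K\<close>, so that \<open>|A + A| \<le> 2 |A| - 1\<close>.  This is the
smallest size that a sumset of integers can have, and it forces \<open>A\<close> to be an arithmetic
progression.  Its common difference is 1, because the lattice points of an origin-symmetric
integer polygon generate the whole lattice and \<open>u\<close> is primitive
(\<open>lattice_generated_by_symmetric_convex\<close>, \<open>symmetric_small_sumset_interval\<close>).  By symmetry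
\<open>A = {-h..h}\<close>, so no vertex of \<open>K\<close>, and thus no point of \<open>K\<close>, is higher than the edge.\<close>

section \<open>Planar cross product and the integer lattice\<close>

definition cross2 :: "real ^ 2 \<Rightarrow> real ^ 2 \<Rightarrow> real" where
  "cross2 u v = u $ 1 * v $ 2 - u $ 2 * v $ 1"

lemma cross2_add: "cross2 u (x + y) = cross2 u x + cross2 u y"
  and cross2_diff: "cross2 u (x - y) = cross2 u x - cross2 u y"
  and cross2_minus: "cross2 u (- x) = - cross2 u x"
  and cross2_scale: "cross2 u (c *\<^sub>R x) = c * cross2 u x"
  and cross2_self: "cross2 u u = 0"
  and cross2_zero: "cross2 u 0 = 0"
  and cross2_swap: "cross2 u x = - cross2 x u"
  by (simp_all add: cross2_def algebra_simps)

lemmas cross2_simps = cross2_add cross2_diff cross2_minus cross2_scale cross2_self cross2_zero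

lemma cross2_in_Ints:
  "u \<in> integer_lattice \<Longrightarrow> x \<in> integer_lattice \<Longrightarrow> cross2 u x \<in> \<int>"
  by (simp add: cross2_def integer_lattice_def)

lemma integer_lattice_add: "x \<in> integer_lattice \<Longrightarrow> y \<in> integer_lattice \<Longrightarrow> x + y \<in> integer_lattice"
  and integer_lattice_diff: "x \<in> integer_lattice \<Longrightarrow> y \<in> integer_lattice \<Longrightarrow> x - y \<in> integer_lattice"
  and integer_lattice_minus: "x \<in> integer_lattice \<Longrightarrow> - x \<in> integer_lattice"
  and integer_lattice_scale: "x \<in> integer_lattice \<Longrightarrow> of_int k *\<^sub>R x \<in> integer_lattice"
  and integer_lattice_zero: "0 \<in> integer_lattice"
  by (simp_all add: integer_lattice_def)

lemma origin_symmetric_minus: "origin_symmetric K \<Longrightarrow> x \<in> K \<Longrightarrow> - x \<in> K"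
  unfolding origin_symmetric_def by blast

section \<open>Symmetric convex sets\<close>

lemma symmetric_convex_zero:
  assumes "convex K" "origin_symmetric K" "x \<in> K"
  shows "0 \<in> K"
proof -
  have "(1/2) *\<^sub>R x + (1/2) *\<^sub>R (- x) \<in> K"
    using assms origin_symmetric_minus by (intro convexD) auto
  then show ?thesis by simp
qed

lemma symmetric_convex_combination:
  assumes K: "convex K" "origin_symmetric K" and p: "p \<in> K" and q: "q \<in> K"
    and st: "\<bar>s\<bar> + \<bar>t\<bar> \<le> 1"
  shows "s *\<^sub>R p + t *\<^sub>R q \<in> K"
proof -
  let ?p = "if s \<ge> 0 then p else - p" and ?q = "if t \<ge> 0 then q else - q"
  have pq: "?p \<in> K" "?q \<in> K"
    using K p q origin_symmetric_minus by auto
  have "\<bar>s\<bar> *\<^sub>R ?p + \<bar>t\<bar> *\<^sub>R ?q + (1 - \<bar>s\<bar> - \<bar>t\<bar>) *\<^sub>R 0 \<in> convex hull {?p, ?q, 0}"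
    unfolding convex_hull_3 using st
    by (intro CollectI exI[of _ "\<bar>s\<bar>"] exI[of _ "\<bar>t\<bar>"] exI[of _ "1 - \<bar>s\<bar> - \<bar>t\<bar>"]) auto
  also have "convex hull {?p, ?q, 0} \<subseteq> K"
    using pq K symmetric_convex_zero[OF K p] by (intro hull_minimal) auto
  finally have "\<bar>s\<bar> *\<^sub>R ?p + \<bar>t\<bar> *\<^sub>R ?q \<in> K" by simp
  then show ?thesis by (auto split: if_splits)
qed

section \<open>Projections and heights\<close>

text \<open>If \<open>n\<close> is \<open>u\<close> turned by a right angle, then the projection of \<open>x\<close> is
\<open>(cross2 u x / (u \<bullet> u)) *\<^sub>R n\<close>, an injective function of the height \<open>cross2 u x\<close>.\<close>

lemma card_perp_projection:
  assumes "u \<noteq> 0"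
  shows "card (perp_projection A u) = card (cross2 u ` A)"
proof -
  define n :: "real ^ 2" where "n = vector [- u $ 2, u $ 1]"
  have uu: "u \<bullet> u \<noteq> 0" using assms by simp
  have "n \<noteq> 0"
    using assms by (auto simp: n_def vec_eq_iff forall_2)
  have "orthogonal_projection ({u}\<^sup>\<bottom>) x = (cross2 u x / (u \<bullet> u)) *\<^sub>R n" for x
  proof -
    have "(u \<bullet> u) *\<^sub>R (x - ((x \<bullet> u) / (u \<bullet> u)) *\<^sub>R u) = (u \<bullet> u) *\<^sub>R x - (x \<bullet> u) *\<^sub>R u"
      using uu by (simp add: algebra_simps)
    also have "\<dots> = cross2 u x *\<^sub>R n"
      by (simp add: vec_eq_iff forall_2 n_def cross2_def inner_vec_def sum_2 algebra_simps)
    also have "\<dots> = (u \<bullet> u) *\<^sub>R ((cross2 u x / (u \<bullet> u)) *\<^sub>R n)"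
      using uu by simp
    finally show ?thesis
      unfolding orthogonal_projection_perp using uu by (metis scaleR_cancel_left)
  qed
  then have "perp_projection A u = (\<lambda>c. (c / (u \<bullet> u)) *\<^sub>R n) ` cross2 u ` A"
    by (simp add: perp_projection_def image_image)
  moreover have "inj (\<lambda>c. (c / (u \<bullet> u)) *\<^sub>R n)"
    using uu \<open>n \<noteq> 0\<close> by (auto simp: inj_def)
  ultimately show ?thesis
    by (metis card_image inj_on_subset subset_UNIV)
qed

definition lattice_heights :: "real ^ 2 \<Rightarrow> (real ^ 2) set \<Rightarrow> int set" where
  "lattice_heights u K = {k. \<exists>x \<in> K \<inter> integer_lattice. cross2 u x = of_int k}"

lemma card_perp_projection_lattice:
  assumes "u \<in> integer_lattice" "u \<noteq> 0"
  shows "card (perp_projection (K \<inter> integer_lattice) u) = card (lattice_heights u K)"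
proof -
  have "cross2 u ` (K \<inter> integer_lattice) = of_int ` lattice_heights u K"
  proof (intro set_eqI iffI)
    fix y assume "y \<in> cross2 u ` (K \<inter> integer_lattice)"
    then obtain x where x: "x \<in> K \<inter> integer_lattice" "y = cross2 u x" by blast
    then obtain k where "cross2 u x = of_int k"
      using cross2_in_Ints[OF assms(1)] by (auto elim: Ints_cases)
    then show "y \<in> of_int ` lattice_heights u K"
      using x by (auto simp: lattice_heights_def)
  qed (force simp: lattice_heights_def)
  then show ?thesis
    using assms by (simp add: card_perp_projection card_image inj_on_def)
qed

section \<open>Symmetric sets of integers with a small sumset\<close>

text \<open>Let \<open>M\<close> be the maximum of \<open>A\<close>.  The translates \<open>A + M\<close> and \<open>A - M\<close> share at most the
point 0, so together they already have \<open>2 |A| - 1\<close> elements; as \<open>S\<close> has no more, every sum of two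
elements of \<open>A\<close> lies in one of them.  Hence the residues of \<open>A\<close> modulo \<open>M\<close> are closed under
addition, and they are all residues because two elements of \<open>A\<close> have an integer combination equal
to 1.  So for \<open>0 < r < M\<close> one of \<open>r\<close> and \<open>r - M\<close> is in \<open>A\<close>.  The sum \<open>a + 0\<close> with
\<open>a > 0\<close> shows that \<open>a - M\<close> is in \<open>A\<close> as well, which together with symmetry makes
both alternatives equivalent.\<close>

lemma symmetric_small_sumset_interval:
  fixes A :: "int set"
  assumes fin: "finite A" and sym: "\<And>a. a \<in> A \<Longrightarrow> - a \<in> A" and zero: "0 \<in> A"
    and gen: "a0 \<in> A" "b0 \<in> A" "s * a0 + t * b0 = 1"
    and S: "finite S" "\<And>a b. a \<in> A \<Longrightarrow> b \<in> A \<Longrightarrow> a + b \<in> S" "card S < 2 * card A"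
  shows "A = {- Max A..Max A}"
proof -
  define M where "M = Max A"
  have MA: "M \<in> A" unfolding M_def using fin zero by (intro Max_in) auto
  have le: "a \<le> M" if "a \<in> A" for a
    unfolding M_def using fin that by simp
  have ge: "- M \<le> a" if "a \<in> A" for a
    using le[OF sym[OF that]] by simp
  define U where "U = (\<lambda>a. a + M) ` A \<union> (\<lambda>a. a - M) ` A"
  have "(\<lambda>a. a + M) ` A \<inter> (\<lambda>a. a - M) ` A \<subseteq> {0}"
  proof
    fix z assume "z \<in> (\<lambda>a. a + M) ` A \<inter> (\<lambda>a. a - M) ` A"
    then obtain a b where "a \<in> A" "b \<in> A" "z = a + M" "z = b - M" by blast
    then show "z \<in> {0}" using ge[of a] le[of b] by simp
  qed
  then have "card ((\<lambda>a. a + M) ` A \<inter> (\<lambda>a. a - M) ` A) \<le> 1"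
    using card_mono[of "{0 :: int}"] by simp
  moreover have "card ((\<lambda>a. a + M) ` A) = card A" "card ((\<lambda>a. a - M) ` A) = card A"
    by (auto intro!: card_image simp: inj_on_def)
  moreover have "card ((\<lambda>a. a + M) ` A) + card ((\<lambda>a. a - M) ` A)
      = card U + card ((\<lambda>a. a + M) ` A \<inter> (\<lambda>a. a - M) ` A)"
    unfolding U_def using fin by (intro card_Un_Int) auto
  ultimately have "card S \<le> card U" using S(3) by linarith
  moreover have "U \<subseteq> S"
    unfolding U_def using S(2) MA sym by (force simp: diff_conv_add_uminus simp del: add_uminus_conv_diff)
  ultimately have "U = S" using S(1) by (simp add: card_seteq)
  then have sum: "a + b - M \<in> A \<or> a + b + M \<in> A" if "a \<in> A" "b \<in> A" for a b
    using S(2)[OF that] unfolding U_def by force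
  \<comment> \<open>the preimage in the integers of the residues of \<open>A\<close> modulo \<open>M\<close>\<close>
  define B where "B = {b. \<exists>a\<in>A. \<exists>k. b = a + k * M}"
  have B_add: "x + y \<in> B" if "x \<in> B" "y \<in> B" for x y
  proof -
    obtain a k b l where ab: "a \<in> A" "b \<in> A" "x = a + k * M" "y = b + l * M"
      using \<open>x \<in> B\<close> \<open>y \<in> B\<close> unfolding B_def by blast
    have "x + y = (a + b - M) + (k + l + 1) * M" "x + y = (a + b + M) + (k + l - 1) * M"
      unfolding ab by (simp_all add: algebra_simps)
    then show ?thesis
      using sum[OF ab(1,2)] unfolding B_def by blast
  qed
  have B_uminus: "- x \<in> B" if x: "x \<in> B" for x
  proof -
    obtain a k where "a \<in> A" "x = a + k * M" using x unfolding B_def by blast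
    then have "- a \<in> A" "- x = - a + (- k) * M" using sym by auto
    then show ?thesis unfolding B_def by blast
  qed
  have AB: "a \<in> B" if "a \<in> A" for a
    using that unfolding B_def by (auto intro!: bexI[of _ a] exI[of _ 0])
  have B_mult: "k * x \<in> B" if x: "x \<in> B" for k x
  proof -
    have "int n * x \<in> B" for n
      by (induction n) (use AB[OF zero] x B_add in \<open>auto simp: distrib_right\<close>)
    from this[of "nat k"] B_uminus[OF this[of "nat (- k)"]] show ?thesis
      by (cases "k \<ge> 0") auto
  qed
  have "1 \<in> B" using B_add[OF B_mult[OF AB[OF gen(1)]] B_mult[OF AB[OF gen(2)]], of s t] gen(3) by simp
  then have B_all: "x \<in> B" for x using B_mult[of 1 x] by simp
  have reflect: "a - M \<in> A" if "a \<in> A" "a > 0" for a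
    using sum[OF that(1) zero] le[of "a + M"] that(2) by auto
  have pos: "r \<in> A" if r: "0 < r" "r < M" for r
  proof -
    obtain a k where a: "a \<in> A" "r = a + k * M" using B_all[of r] unfolding B_def by blast
    have "k * M < 2 * M" "(- 1) * M < k * M" using a(2) r le[OF a(1)] ge[OF a(1)] by linarith+
    moreover have "0 < M" using r by linarith
    ultimately have "k < 2" "-1 < k" using mult_less_cancel_right_pos by blast+
    then consider "k = 0" | "k = 1" by linarith
    then show ?thesis
    proof cases
      case 2
      then have "- a = M - r" "- a \<in> A" using a sym by auto
      then have "M - r - M \<in> A" using reflect[of "M - r"] r by simp
      then show ?thesis using sym by force
    qed (use a in simp)
  qed
  have "r \<in> A" if r: "- M \<le> r" "r \<le> M" for r
  proof -
    consider "r = 0" | "r = M" | "r = - M" | "0 < r" "r < M" | "0 < - r" "- r < M"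
      using r by linarith
    then show ?thesis
      by cases (use zero MA sym pos[of r] sym[OF pos[of "- r"]] in auto)
  qed
  then show ?thesis unfolding M_def[symmetric] using le ge by auto
qed

section \<open>Lattice points of symmetric polygons\<close>

text \<open>Among the independent pairs of lattice points in \<open>K\<close>, take \<open>p\<close> and \<open>q\<close> with \<open>|cross2 p q|\<close>
minimal.  Subtracting from a lattice point \<open>x = a p + b q\<close> its rounding to the lattice generated
by \<open>p\<close> and \<open>q\<close> leaves a remainder \<open>r = s p + t q\<close> with \<open>|s|, |t| \<le> 1/2\<close>.  By symmetry
and convexity \<open>r\<close> is in \<open>K\<close>, and its cross products with \<open>p\<close> and \<open>q\<close> are at most half the
minimum.  So they vanish, and \<open>r = 0\<close>.\<close>

lemma lattice_generated_by_symmetric_convex: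
  assumes K: "convex K" "origin_symmetric K"
    and v: "v \<in> K \<inter> integer_lattice" and w: "w \<in> K \<inter> integer_lattice" and vw: "cross2 v w \<noteq> 0"
  obtains p q where "p \<in> K \<inter> integer_lattice" "q \<in> K \<inter> integer_lattice"
    "\<And>x. x \<in> integer_lattice \<Longrightarrow> \<exists>s t :: int. x = of_int s *\<^sub>R p + of_int t *\<^sub>R q"
proof -
  define P where "P n \<longleftrightarrow> n > 0 \<and> (\<exists>p \<in> K \<inter> integer_lattice. \<exists>q \<in> K \<inter> integer_lattice. \<bar>cross2 p q\<bar> = real n)" for n
  have P: "\<exists>n. P n \<and> \<bar>cross2 p q\<bar> = real n"
    if "p \<in> K \<inter> integer_lattice" "q \<in> K \<inter> integer_lattice" "cross2 p q \<noteq> 0" for p q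
  proof -
    have "cross2 p q \<in> \<int>" using that cross2_in_Ints by blast
    then obtain k where "cross2 p q = of_int k" by (auto elim: Ints_cases)
    then have "\<bar>cross2 p q\<bar> = real (nat \<bar>k\<bar>)" "nat \<bar>k\<bar> > 0" using that(3) by auto
    then show ?thesis unfolding P_def using that by blast
  qed
  define D where "D = (LEAST n. P n)"
  have "P D" unfolding D_def using P[OF v w vw] LeastI_ex by blast
  then obtain p q where pq: "p \<in> K \<inter> integer_lattice" "q \<in> K \<inter> integer_lattice"
    and D: "\<bar>cross2 p q\<bar> = real D" "D > 0" unfolding P_def by blast
  have small: "cross2 p' q' = 0" if "p' \<in> K \<inter> integer_lattice" "q' \<in> K \<inter> integer_lattice"
    "\<bar>cross2 p' q'\<bar> < real D" for p' q'
    using P[OF that(1,2)] that(3) Least_le[of P] unfolding D_def by fastforce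
  define d where "d = cross2 p q"
  have d: "d \<noteq> 0" "\<bar>d\<bar> = real D" using D by (auto simp: d_def)
  show thesis
  proof
    fix x :: "real ^ 2" assume x: "x \<in> integer_lattice"
    define a b where "a = cross2 x q / d" and "b = cross2 p x / d"
    \<comment> \<open>Cramer's rule\<close>
    have expand: "x = a *\<^sub>R p + b *\<^sub>R q"
    proof -
      have "d *\<^sub>R x = cross2 x q *\<^sub>R p + cross2 p x *\<^sub>R q"
        by (simp add: d_def vec_eq_iff forall_2 cross2_def algebra_simps)
      also have "\<dots> = d *\<^sub>R (a *\<^sub>R p + b *\<^sub>R q)"
        using d by (simp add: a_def b_def scaleR_add_right)
      finally show ?thesis using d by (metis scaleR_cancel_left)
    qed
    define s t where "s = a - of_int (round a)" and "t = b - of_int (round b)"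
    have st: "\<bar>s\<bar> \<le> 1/2" "\<bar>t\<bar> \<le> 1/2"
      using of_int_round_abs_le[of a] of_int_round_abs_le[of b] by (auto simp: s_def t_def abs_minus_commute)
    define r where "r = s *\<^sub>R p + t *\<^sub>R q"
    have r: "r = x - (of_int (round a) *\<^sub>R p + of_int (round b) *\<^sub>R q)"
      unfolding r_def by (subst expand) (simp add: s_def t_def algebra_simps)
    have rK: "r \<in> K \<inter> integer_lattice"
    proof
      show "r \<in> K" unfolding r_def using st pq by (intro symmetric_convex_combination K) auto
      show "r \<in> integer_lattice"
        unfolding r using x pq by (intro integer_lattice_diff integer_lattice_add integer_lattice_scale) auto
    qed
    have c1: "cross2 p r = t * d" by (simp add: r_def cross2_simps d_def)
    have c2: "cross2 q r = - (s * d)" using cross2_swap[of q p] by (simp add: r_def cross2_simps d_def)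
    have half: "\<bar>z * d\<bar> < real D" if "\<bar>z\<bar> \<le> 1/2" for z
      using mult_right_mono[OF that, of "real D"] D d by (simp add: abs_mult)
    have "t * d = 0" using small[OF pq(1) rK] half[OF st(2)] c1 by simp
    moreover have "s * d = 0" using small[OF pq(2) rK] half[OF st(1)] c2 by simp
    ultimately have "r = 0" using d by (simp add: r_def)
    then show "\<exists>s t :: int. x = of_int s *\<^sub>R p + of_int t *\<^sub>R q" using r by auto
  qed (use pq in auto)
qed

lemma convex_integer_polygonD:
  assumes "convex_integer_polygon K"
  shows "compact K" "convex K" "interior K \<noteq> {}" "polytope K"
    "\<And>v. v extreme_point_of K \<Longrightarrow> v \<in> K \<inter> integer_lattice"
    "K = convex hull {v. v extreme_point_of K}"
proof -
  show "compact K" "convex K" "interior K \<noteq> {}" "polytope K"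
    using assms unfolding convex_integer_polygon_def convex_body_def by blast+
  then show "K = convex hull {v. v extreme_point_of K}"
    by (intro Krein_Milman_Minkowski)
  show "v \<in> K \<inter> integer_lattice" if "v extreme_point_of K" for v
    using assms that unfolding convex_integer_polygon_def extreme_point_of_def by blast
qed

lemma integer_polygon_subset_convex:
  assumes K: "convex_integer_polygon K" and "convex C" "K \<inter> integer_lattice \<subseteq> C"
  shows "K \<subseteq> C"
proof -
  have "{v. v extreme_point_of K} \<subseteq> C"
    using convex_integer_polygonD(5)[OF K] assms(3) by blast
  then show ?thesis
    by (subst convex_integer_polygonD(6)[OF K]) (rule hull_minimal[where S = convex, OF _ assms(2)])
qed

lemma cross2_inner: "cross2 u x = vector [- u $ 2, u $ 1] \<bullet> x"
  by (simp add: cross2_def inner_vec_def sum_2)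

text \<open>Otherwise all vertices, hence all of the polygon, would lie on one line through the origin.\<close>

lemma integer_polygon_independent_points:
  assumes K: "convex_integer_polygon K"
  obtains v w where "v \<in> K \<inter> integer_lattice" "w \<in> K \<inter> integer_lattice" "cross2 v w \<noteq> 0"
proof -
  have flat: False if "u \<noteq> 0" "K \<inter> integer_lattice \<subseteq> {x. cross2 u x = 0}" for u :: "real ^ 2"
  proof -
    have eq: "{x. cross2 u x = 0} = {x. vector [- u $ 2, u $ 1] \<bullet> x = 0}"
      by (simp add: cross2_inner)
    have "convex {x. cross2 u x = 0}"
      unfolding eq by (rule convex_hyperplane)
    then have "K \<subseteq> {x. cross2 u x = 0}"
      using that(2) by (rule integer_polygon_subset_convex[OF K])
    moreover have "interior {x. cross2 u x = 0} = {}"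
      unfolding eq using that(1) by (intro interior_hyperplane) (auto simp: vec_eq_iff forall_2)
    ultimately show False
      using interior_mono convex_integer_polygonD(3)[OF K] by blast
  qed
  obtain v where v: "v \<in> K \<inter> integer_lattice" "v \<noteq> 0"
  proof -
    have "axis 1 1 \<noteq> (0 :: real ^ 2)" by (simp add: axis_eq_0_iff)
    then obtain v where "v \<in> K \<inter> integer_lattice" "cross2 (axis 1 1) v \<noteq> 0"
      using flat by blast
    then show thesis using that[of v] by (cases "v = 0") (simp_all add: cross2_zero)
  qed
  then obtain w where "w \<in> K \<inter> integer_lattice" "cross2 v w \<noteq> 0"
    using flat[of v] by blast
  then show thesis using v that by blast
qed

lemma finite_lattice_heights:
  assumes "compact K"
  shows "finite (lattice_heights u K)"
proof -
  have "bounded (cross2 u ` K)"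
    unfolding cross2_inner using assms
    by (intro compact_imp_bounded compact_continuous_image continuous_intros)
  then obtain b where b: "\<And>x. x \<in> K \<Longrightarrow> \<bar>cross2 u x\<bar> \<le> b"
    by (auto simp: bounded_iff)
  have "lattice_heights u K \<subseteq> {- \<lceil>b\<rceil>..\<lceil>b\<rceil>}"
  proof
    fix k assume "k \<in> lattice_heights u K"
    then have "\<bar>of_int k\<bar> \<le> b" using b by (force simp: lattice_heights_def)
    then show "k \<in> {- \<lceil>b\<rceil>..\<lceil>b\<rceil>}" by (simp add: abs_le_iff) linarith
  qed
  then show ?thesis using finite_subset by blast
qed

text \<open>The midpoint of two points of \<open>K\<close> is in \<open>K\<close>, so their sum is in \<open>2 K\<close>.\<close>

lemma lattice_heights_add:
  assumes "convex K" "a \<in> lattice_heights u K" "b \<in> lattice_heights u K"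
  shows "a + b \<in> lattice_heights u (dilate 2 K)"
proof -
  obtain x y where xy: "x \<in> K" "y \<in> K" "x \<in> integer_lattice" "y \<in> integer_lattice"
    "cross2 u x = of_int a" "cross2 u y = of_int b"
    using assms(2,3) by (auto simp: lattice_heights_def)
  have "(1/2) *\<^sub>R x + (1/2) *\<^sub>R y \<in> K" using xy assms(1) by (intro convexD) auto
  then have "2 *\<^sub>R ((1/2) *\<^sub>R x + (1/2) *\<^sub>R y) \<in> dilate 2 K" unfolding dilate_def by blast
  then have "x + y \<in> dilate 2 K" by (simp add: scaleR_add_right)
  then show ?thesis
    unfolding lattice_heights_def using xy
    by (auto intro!: bexI[of _ "x + y"] integer_lattice_add simp: cross2_add)
qed

text \<open>The generation hypothesis of \<open>symmetric_small_sumset_interval\<close> comes from the vector \<open>m\<close> of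
height 1: it is an integer combination of two lattice points of \<open>K\<close>, so 1 is the same
combination of their heights.\<close>

lemma integer_polygon_heights_interval:
  assumes K: "convex_integer_polygon K" "origin_symmetric K"
    and u: "u \<in> integer_lattice" "m \<in> integer_lattice" "cross2 u m = 1"
    and card: "card (lattice_heights u (dilate 2 K)) < 2 * card (lattice_heights u K)"
  shows "lattice_heights u K = {- Max (lattice_heights u K)..Max (lattice_heights u K)}"
proof -
  note D = convex_integer_polygonD[OF K(1)]
  obtain v w where vw: "v \<in> K \<inter> integer_lattice" "w \<in> K \<inter> integer_lattice" "cross2 v w \<noteq> 0"
    using integer_polygon_independent_points K by blast
  then obtain p q where pq: "p \<in> K \<inter> integer_lattice" "q \<in> K \<inter> integer_lattice"
    and gen: "\<And>x. x \<in> integer_lattice \<Longrightarrow> \<exists>s t :: int. x = of_int s *\<^sub>R p + of_int t *\<^sub>R q"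
    using lattice_generated_by_symmetric_convex D(2) K(2) by blast
  obtain a b where ab: "cross2 u p = of_int a" "cross2 u q = of_int b"
    using cross2_in_Ints[OF u(1)] pq by (metis IntD2 Ints_cases)
  obtain s t :: int where "m = of_int s *\<^sub>R p + of_int t *\<^sub>R q" using gen u(2) by blast
  then have "real_of_int (s * a + t * b) = 1" using u(3) by (simp add: cross2_simps ab)
  then have st: "s * a + t * b = 1" by linarith
  have "0 \<in> K" using symmetric_convex_zero D(2) K(2) pq by blast
  show ?thesis
  proof (rule symmetric_small_sumset_interval)
    show "finite (lattice_heights u K)" using finite_lattice_heights D(1) .
    show "0 \<in> lattice_heights u K" using \<open>0 \<in> K\<close> integer_lattice_zero
      by (auto simp: lattice_heights_def cross2_zero intro!: bexI[of _ 0])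
    show "- a \<in> lattice_heights u K" if "a \<in> lattice_heights u K" for a
      using that origin_symmetric_minus[OF K(2)] integer_lattice_minus
      by (force simp: lattice_heights_def cross2_minus)
    show "a \<in> lattice_heights u K" "b \<in> lattice_heights u K"
      using pq ab by (auto simp: lattice_heights_def)
    show "s * a + t * b = 1" by (fact st)
    show "finite (lattice_heights u (dilate 2 K))"
      using D(1) by (intro finite_lattice_heights) (simp add: dilate_def compact_scaling)
    show "a + b \<in> lattice_heights u (dilate 2 K)"
      if "a \<in> lattice_heights u K" "b \<in> lattice_heights u K" for a b
      using lattice_heights_add D(2) that by blast
  qed (fact card)
qed

section \<open>Edges of integer polygons\<close>

text \<open>A polytope with interior points is the intersection of the half-planes defined by its facets, so
one of them excludes \<open>x\<close>.  That facet is one-dimensional and the convex hull of its extreme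
points, hence it has at least two of these.\<close>

lemma polytope_separating_facet_vertices:
  fixes L :: "(real ^ 2) set"
  assumes L: "polytope L" "interior L \<noteq> {}" and x: "x \<notin> L"
  obtains a b v w where "v extreme_point_of L" "w extreme_point_of L" "v \<noteq> w"
    "L \<subseteq> {y. a \<bullet> y \<le> b}" "a \<bullet> v = b" "a \<bullet> w = b" "a \<bullet> x > b"
proof -
  have hull: "affine hull L = UNIV" using L(2) by (rule affine_hull_nonempty_interior)
  have "polyhedron L" using L(1) by (rule polytope_imp_polyhedron)
  then obtain F where "finite F" and LF: "L = affine hull L \<inter> \<Inter>F"
    and h: "\<forall>h\<in>F. \<exists>a b. a \<noteq> 0 \<and> h = {x. a \<bullet> x \<le> b}"
    and min: "\<And>F'. F' \<subset> F \<Longrightarrow> L \<subset> affine hull L \<inter> \<Inter>F'"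
    unfolding polyhedron_Int_affine_minimal by metis
  from h obtain a b where ab: "\<And>h. h \<in> F \<Longrightarrow> a h \<noteq> 0 \<and> h = {x. a h \<bullet> x \<le> b h}" by metis
  obtain h where hF: "h \<in> F" and xh: "x \<notin> h" using x LF hull by auto
  let ?E = "L \<inter> {x. a h \<bullet> x = b h}"
  have facet: "?E facet_of L"
    using facet_of_polyhedron_explicit[OF \<open>finite F\<close> LF ab min] hF by blast
  then have face: "?E face_of L" and dim: "aff_dim ?E = 1"
    using aff_dim_nonempty_interior[OF L(2)] by (auto simp: facet_of_def)
  have cE: "compact ?E" "convex ?E"
    using face L(1) face_of_imp_compact polytope_imp_compact polytope_imp_convex face_of_imp_convex by blast+
  have E: "?E = convex hull {v. v extreme_point_of ?E}"
    using Krein_Milman_Minkowski[OF cE] .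
  have "\<not> (\<exists>v. {v. v extreme_point_of ?E} \<subseteq> {v})"
  proof
    assume "\<exists>v. {v. v extreme_point_of ?E} \<subseteq> {v}"
    then obtain v where "?E \<subseteq> {v}" using E by (metis convex_hull_singleton hull_mono)
    then have "aff_dim ?E \<le> 0" by (metis aff_dim_subset aff_dim_sing)
    then show False using dim by simp
  qed
  then obtain v w where vw: "v extreme_point_of ?E" "w extreme_point_of ?E" "v \<noteq> w" by blast
  show thesis
  proof
    show "v extreme_point_of L" "w extreme_point_of L"
      using vw face extreme_point_of_face by blast+
    show "L \<subseteq> {y. a h \<bullet> y \<le> b h}" using LF ab[OF hF] hF by blast
    show "a h \<bullet> v = b h" "a h \<bullet> w = b h" using vw by (auto simp: extreme_point_of_def)
    show "a h \<bullet> x > b h" using xh ab[OF hF] by force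
  qed fact
qed

text \<open>Primitivity of \<open>u\<close> is expressed by the existence of a lattice vector \<open>m\<close> of height 1, which is
Bezout's identity for the coordinates of \<open>u\<close>.\<close>

lemma integer_lattice_primitive_direction:
  assumes z: "(z :: real ^ 2) \<in> integer_lattice" "z \<noteq> 0"
  obtains u m g where "u \<in> integer_lattice" "m \<in> integer_lattice" "cross2 u m = 1"
    "1 \<le> g" "z = g *\<^sub>R u"
proof -
  obtain i j where ij: "z $ 1 = of_int i" "z $ 2 = of_int j"
  proof -
    have "z $ 1 \<in> \<int>" "z $ 2 \<in> \<int>" using z(1) by (simp_all add: integer_lattice_def)
    then show thesis using that by (elim Ints_cases) blast
  qed
  have nz: "i \<noteq> 0 \<or> j \<noteq> 0" using z(2) ij by (auto simp: vec_eq_iff forall_2)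
  define g where "g = gcd i j"
  have "g > 0" using nz by (simp add: g_def)
  obtain i' j' where ij': "i = g * i'" "j = g * j'" by (metis g_def dvdE gcd_dvd1 gcd_dvd2)
  obtain s t where "s * i + t * j = g" using bezout_int[of i j] g_def by blast
  then have "g * (s * i' + t * j') = g * 1" using ij' by (simp add: algebra_simps)
  then have st: "s * i' + t * j' = 1" using \<open>g > 0\<close> by simp
  define u m :: "real ^ 2" where "u = vector [of_int i', of_int j']" and "m = vector [of_int (- t), of_int s]"
  show thesis
  proof
    show "u \<in> integer_lattice" "m \<in> integer_lattice"
      by (simp_all add: integer_lattice_def forall_2 u_def m_def)
    have "cross2 u m = of_int (s * i' + t * j')" by (simp add: cross2_def u_def m_def)
    then show "cross2 u m = 1" using st by simp
    show "1 \<le> real_of_int g" using \<open>g > 0\<close> by linarith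
    show "z = of_int g *\<^sub>R u" by (simp add: vec_eq_iff forall_2 ij ij' u_def)
  qed
qed

text \<open>The linear form \<open>a\<close> defining an edge from \<open>v\<close> to \<open>w\<close> vanishes on \<open>w - v\<close>, so it is a
multiple of the height along the primitive vector \<open>u\<close> in that direction.  The sign of the
multiple is unknown; absolute values absorb it, since the edge has a mirror image.\<close>

lemma integer_polygon_separating_edge:
  assumes L: "convex_integer_polygon L" "origin_symmetric L" and x: "x \<notin> L"
  obtains u m v where "u \<in> integer_lattice" "m \<in> integer_lattice" "cross2 u m = 1"
    "v \<in> L \<inter> integer_lattice" "v + u \<in> L"
    "\<And>y. y \<in> L \<Longrightarrow> \<bar>cross2 u y\<bar> \<le> \<bar>cross2 u v\<bar>" "\<bar>cross2 u v\<bar> < \<bar>cross2 u x\<bar>"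
proof -
  note D = convex_integer_polygonD[OF L(1)]
  obtain a b v w where vw: "v extreme_point_of L" "w extreme_point_of L" "v \<noteq> w"
    and ab: "L \<subseteq> {y. a \<bullet> y \<le> b}" "a \<bullet> v = b" "a \<bullet> w = b" "a \<bullet> x > b"
    using polytope_separating_facet_vertices[OF D(4,3) x] .
  have v: "v \<in> L \<inter> integer_lattice" and w: "w \<in> L \<inter> integer_lattice" using D(5) vw by auto
  then have wv: "w - v \<in> integer_lattice" "w - v \<noteq> 0"
    using vw(3) integer_lattice_diff by auto
  obtain u m g where u: "u \<in> integer_lattice" "m \<in> integer_lattice" "cross2 u m = 1"
    and g: "1 \<le> g" "w - v = g *\<^sub>R u"
    using integer_lattice_primitive_direction[OF wv] .
  have "a \<bullet> (w - v) = 0" using ab by (simp add: inner_diff_right)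
  then have au: "a \<bullet> u = 0" using g by simp
  define c where "c = a \<bullet> m"
  have ac: "a \<bullet> y = c * cross2 u y" for y
  proof -
    have "y = cross2 u y *\<^sub>R m + cross2 y m *\<^sub>R u"
    proof -
      have "cross2 u m *\<^sub>R y = cross2 u y *\<^sub>R m + cross2 y m *\<^sub>R u"
        by (simp add: vec_eq_iff forall_2 cross2_def algebra_simps)
      then show ?thesis using u(3) by simp
    qed
    then have "a \<bullet> y = a \<bullet> (cross2 u y *\<^sub>R m + cross2 y m *\<^sub>R u)" by simp
    then show ?thesis using au by (simp add: c_def inner_add_right)
  qed
  have b: "b = c * cross2 u v" using ab(2) ac by simp
  have c: "c \<noteq> 0" using ab(4) ac b by auto
  have bound: "\<bar>c * cross2 u y\<bar> \<le> b" if "y \<in> L" for y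
    using ab(1) that origin_symmetric_minus[OF L(2) that] ac[of y] by (force simp: abs_le_iff)
  have bv: "b = \<bar>c\<bar> * \<bar>cross2 u v\<bar>" using bound[of v] v b by (simp add: abs_mult[symmetric])
  show thesis
  proof
    have "v + u = (1 - 1/g) *\<^sub>R v + (1/g) *\<^sub>R w"
    proof -
      have "w = v + g *\<^sub>R u" using g(2) by (simp add: algebra_simps)
      then show ?thesis using g(1) by (simp add: algebra_simps)
    qed
    then show "v + u \<in> L" using v w g(1) D(2) by (auto intro!: convexD)
    show "\<bar>cross2 u y\<bar> \<le> \<bar>cross2 u v\<bar>" if "y \<in> L" for y
      using bound[OF that] c unfolding bv abs_mult by simp
    have "b < \<bar>c\<bar> * \<bar>cross2 u x\<bar>" using ab(4) ac[of x] by (simp add: abs_mult[symmetric])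
    then show "\<bar>cross2 u v\<bar> < \<bar>cross2 u x\<bar>" unfolding bv using c by simp
  qed (use u v in auto)
qed

text \<open>The parallelogram with vertices \<open>v\<close>, \<open>v + u\<close>, \<open>- v\<close>, \<open>- (v + u)\<close> lies in \<open>L\<close>.  It meets
the line of height \<open>j = s * cross2 u v\<close> in the points \<open>s v + t u\<close> with \<open>t\<close> between
\<open>(s - 1) / 2\<close> and \<open>(s + 1) / 2\<close>.  The lattice points on that line are \<open>j m + k u\<close> for
integers \<open>k\<close>, and one of them falls into this range of length one.\<close>

lemma lattice_heights_of_edge_direction:
  assumes L: "convex L" "origin_symmetric L"
    and u: "u \<in> integer_lattice" "m \<in> integer_lattice" "cross2 u m = 1"
    and v: "v \<in> L \<inter> integer_lattice" "v + u \<in> L" and h: "\<bar>cross2 u v\<bar> = of_int h"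
    and bound: "\<And>y. y \<in> L \<Longrightarrow> \<bar>cross2 u y\<bar> \<le> \<bar>cross2 u v\<bar>"
  shows "lattice_heights u L = {- h..h}"
proof
  show "lattice_heights u L \<subseteq> {- h..h}"
  proof
    fix k assume "k \<in> lattice_heights u L"
    then have "\<bar>real_of_int k\<bar> \<le> of_int h" using bound h by (force simp: lattice_heights_def)
    then show "k \<in> {- h..h}" by (simp add: abs_le_iff)
  qed
  show "{- h..h} \<subseteq> lattice_heights u L"
  proof
    fix j assume j: "j \<in> {- h..h}"
    show "j \<in> lattice_heights u L"
    proof (cases "h = 0")
      case True
      then show ?thesis using v(1) h j by (auto simp: lattice_heights_def)
    next
      case False
      define s where "s = real_of_int j / cross2 u v"
      have cv: "cross2 u v \<noteq> 0" using False h by auto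
      have "\<bar>real_of_int j\<bar> \<le> of_int h" using j by (simp add: abs_le_iff)
      then have s: "\<bar>s\<bar> \<le> 1" using h cv by (simp add: s_def abs_divide)
      \<comment> \<open>\<open>z\<close> is a lattice point of height \<open>j\<close>; the fractional part \<open>\<theta>\<close> is what remains
        of its offset from the left end of the chord once \<open>z\<close> is moved into the chord by \<open>k\<close>
        steps of \<open>u\<close>\<close>
      define z where "z = of_int j *\<^sub>R m"
      have z: "cross2 u z = of_int j" "z \<in> integer_lattice"
        using u integer_lattice_scale by (simp_all add: z_def cross2_scale)
      define \<tau> where "\<tau> = cross2 (z - s *\<^sub>R v) m"
      have "cross2 u (z - s *\<^sub>R v) = 0" using cv z by (simp add: cross2_simps s_def)
      moreover have "cross2 u m *\<^sub>R (z - s *\<^sub>R v) = cross2 u (z - s *\<^sub>R v) *\<^sub>R m + \<tau> *\<^sub>R u"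
        by (simp add: \<tau>_def vec_eq_iff forall_2 cross2_def algebra_simps)
      ultimately have \<tau>: "z - s *\<^sub>R v = \<tau> *\<^sub>R u" using u(3) by simp
      define \<theta> where "\<theta> = frac (\<tau> - (s - 1) / 2)"
      define k where "k = - \<lfloor>\<tau> - (s - 1) / 2\<rfloor>"
      have \<theta>: "0 \<le> \<theta>" "\<theta> \<le> 1" using frac_ge_0 frac_lt_1[of "\<tau> - (s - 1) / 2"] by (auto simp: \<theta>_def)
      have tk: "\<tau> + of_int k = (s - 1) / 2 + \<theta>" by (simp add: \<theta>_def k_def frac_def)
      define P where "P = z + of_int k *\<^sub>R u"
      have "P = s *\<^sub>R v + (\<tau> + of_int k) *\<^sub>R u"
        using \<tau> by (simp add: P_def algebra_simps)
      also have "\<dots> = ((1 + s) / 2) *\<^sub>R ((1 - \<theta>) *\<^sub>R v + \<theta> *\<^sub>R (v + u))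
          + ((1 - s) / 2) *\<^sub>R (\<theta> *\<^sub>R (- v) + (1 - \<theta>) *\<^sub>R (- (v + u)))"
        unfolding tk by (simp add: vec_eq_iff forall_2 field_simps)
      also have "\<dots> \<in> L"
      proof (rule convexD[OF L(1)])
        have "- v \<in> L" "- (v + u) \<in> L" using v origin_symmetric_minus[OF L(2)] by blast+
        then show "(1 - \<theta>) *\<^sub>R v + \<theta> *\<^sub>R (v + u) \<in> L" "\<theta> *\<^sub>R (- v) + (1 - \<theta>) *\<^sub>R (- (v + u)) \<in> L"
          using v \<theta> by (intro convexD[OF L(1)]; simp)+
      qed (use s in \<open>auto simp: field_simps\<close>)
      finally have "P \<in> L" .
      moreover have "P \<in> integer_lattice" unfolding P_def using z u integer_lattice_add integer_lattice_scale by blast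
      moreover have "cross2 u P = of_int j" using z by (simp add: P_def cross2_simps)
      ultimately show ?thesis by (auto simp: lattice_heights_def)
    qed
  qed
qed

section \<open>Determination by lattice projection counts\<close>

text \<open>A point of \<open>K\<close> outside \<open>L\<close> lies strictly beyond some edge of \<open>L\<close>.  Counting heights along
that edge shows that the lattice points of \<open>K\<close> attain the same heights as those of \<open>L\<close>; in
particular the vertices of \<open>K\<close> stay in the strip between the edge and its mirror image,
and so does \<open>K\<close>.\<close>

lemma integer_polygon_subset_by_lattice_projections:
  assumes K: "convex_integer_polygon K" "origin_symmetric K"
    and L: "convex_integer_polygon L" "origin_symmetric L"
    and c1: "\<And>u. u \<in> integer_lattice \<Longrightarrow>
      card (perp_projection (K \<inter> integer_lattice) u) =
      card (perp_projection (L \<inter> integer_lattice) u)"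
    and c2: "\<And>u. u \<in> integer_lattice \<Longrightarrow>
      card (perp_projection (dilate 2 K \<inter> integer_lattice) u) =
      card (perp_projection (dilate 2 L \<inter> integer_lattice) u)"
  shows "K \<subseteq> L"
proof (rule ccontr)
  assume "\<not> K \<subseteq> L"
  then obtain x where xK: "x \<in> K" and xL: "x \<notin> L" by blast
  obtain u m v where u: "u \<in> integer_lattice" "m \<in> integer_lattice" "cross2 u m = 1"
    and v: "v \<in> L \<inter> integer_lattice" "v + u \<in> L"
    and bound: "\<And>y. y \<in> L \<Longrightarrow> \<bar>cross2 u y\<bar> \<le> \<bar>cross2 u v\<bar>"
    and x: "\<bar>cross2 u v\<bar> < \<bar>cross2 u x\<bar>"
    using integer_polygon_separating_edge[OF L xL] by metis
  have u0: "u \<noteq> 0" using u(3) by (auto simp: cross2_def)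
  obtain h where h: "\<bar>cross2 u v\<bar> = of_int h"
    using cross2_in_Ints[OF u(1), of v] v(1) by (metis IntD2 Ints_abs Ints_cases)
  have "h \<ge> 0" using h by linarith
  have hL: "lattice_heights u L = {- h..h}"
    using lattice_heights_of_edge_direction convex_integer_polygonD(2) L u v h bound by blast
  have "lattice_heights u (dilate 2 L) \<subseteq> {- (2 * h)..2 * h}"
  proof
    fix k assume "k \<in> lattice_heights u (dilate 2 L)"
    then obtain y where "y \<in> L" "2 * cross2 u y = of_int k"
      by (auto simp: lattice_heights_def dilate_def cross2_scale)
    then have "\<bar>real_of_int k\<bar> \<le> of_int (2 * h)" using bound[of y] h by auto
    then show "k \<in> {- (2 * h)..2 * h}" by (simp add: abs_le_iff)
  qed
  then have "card (lattice_heights u (dilate 2 L)) \<le> nat (4 * h + 1)"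
    using card_mono[of "{- (2 * h)..2 * h}"] by fastforce
  then have card2K: "card (lattice_heights u (dilate 2 K)) \<le> nat (4 * h + 1)"
    using c2[OF u(1)] card_perp_projection_lattice[OF u(1) u0] by simp
  have cardK: "card (lattice_heights u K) = nat (2 * h + 1)"
    using c1[OF u(1)] card_perp_projection_lattice[OF u(1) u0] hL by simp
  define M where "M = Max (lattice_heights u K)"
  have hK: "lattice_heights u K = {- M..M}"
    unfolding M_def using card2K cardK \<open>h \<ge> 0\<close>
    by (intro integer_polygon_heights_interval[OF K u]) linarith
  then have "M = h" using cardK \<open>h \<ge> 0\<close> by simp
  have "K \<subseteq> {y. \<bar>cross2 u y\<bar> \<le> of_int h}"
  proof (rule integer_polygon_subset_convex[OF K(1)])
    have "{y. \<bar>cross2 u y\<bar> \<le> of_int h} =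
        {y. vector [- u $ 2, u $ 1] \<bullet> y \<le> of_int h} \<inter> {y. vector [- u $ 2, u $ 1] \<bullet> y \<ge> - of_int h}"
      by (auto simp: cross2_inner abs_le_iff)
    then show "convex {y. \<bar>cross2 u y\<bar> \<le> of_int h}"
      by (simp add: convex_Int convex_halfspace_le convex_halfspace_ge)
    show "K \<inter> integer_lattice \<subseteq> {y. \<bar>cross2 u y\<bar> \<le> of_int h}"
    proof
      fix y assume y: "y \<in> K \<inter> integer_lattice"
      then obtain k where k: "cross2 u y = of_int k"
        using cross2_in_Ints[OF u(1)] by (auto elim: Ints_cases)
      then have "k \<in> lattice_heights u K" using y by (auto simp: lattice_heights_def)
      then have "\<bar>k\<bar> \<le> h" using hK \<open>M = h\<close> by auto
      then show "y \<in> {y. \<bar>cross2 u y\<bar> \<le> of_int h}" using k by (simp flip: of_int_abs)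
    qed
  qed
  then show False using xK x h by auto
qed

theorem theorem1p3:
  fixes K L :: "(real ^ 2) set"
  assumes "convex_integer_polygon K" and "origin_symmetric K"
    and "convex_integer_polygon L" and "origin_symmetric L"
    and "\<And>u. u \<in> integer_lattice \<Longrightarrow>
      card (perp_projection (K \<inter> integer_lattice) u) =
      card (perp_projection (L \<inter> integer_lattice) u)"
    and "\<And>u. u \<in> integer_lattice \<Longrightarrow>
      card (perp_projection (dilate 2 K \<inter> integer_lattice) u) =
      card (perp_projection (dilate 2 L \<inter> integer_lattice) u)"
  shows "K = L"
proof
  show "K \<subseteq> L"
    using assms by (rule integer_polygon_subset_by_lattice_projections)
  show "L \<subseteq> K"
    using assms(3,4,1,2) assms(5,6)[symmetric] by (rule integer_polygon_subset_by_lattice_projections)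
qed

end
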